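(* Let $d>r\geq 1$ be integers and let $U,V\in\mathbb{C}^{d\times r}$ be arbitrary. For $z\in\mathbb{C}$ define $$\mathcal{M}_{U,V}(z):=\begin{bmatrix} |z|^2 I - z\,U^*V & (|z|^2 I - z\,U^*V)\,U^*U\\ V^*V & |z|^2 I-\overline{z}\,V^*U+V^*V\,U^*U\end{bmatrix}\in\mathbb{C}^{2r\times 2r}.$$ Then for every $z\in\mathbb{C}$ all eigenvalues of $\mathcal{M}_{U,V}(z)$ are real and nonnegative, and $$\mu_{U,V}(z):=\sqrt{\lambda_{\min}\big(\mathcal{M}_{U,V}(z)\big)}=\sigma_{\min}(zI-UV^* ).$$ Consequently, for every $\varepsilon>0$, the $\varepsilon$-pseudospectrum of $A=UV^*$ is $$\Lambda_\varepsilon(A)=\{z\in\mathbb{C}:\ \mu_{U,V}(z)\le\varepsilon\}.$$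
   Context: $\|\cdot\|$ is the spectral (Euclidean operator) norm, $^*$ is conjugate transpose, $\sigma_{\min}$ is the smallest singular value, and $\lambda_{\min}$ of a square matrix with real spectrum is its smallest eigenvalue. For $A\in\mathbb{C}^{d\times d}$ and $\varepsilon>0$ the $\varepsilon$-pseudospectrum is $\Lambda_\varepsilon(A)=\{z\in\mathbb{C}:\|(A-zI)^{-1}\|^{-1}\le\varepsilon\}$, with the convention $\|(A-zI)^{-1}\|^{-1}=0$ when $A-zI$ is singular. *)

theory Defs
  imports "HOL-Analysis.Analysis"
begin

text \<open>Matrices with \<open>m\<close> rows and \<open>n\<close> columns have type \<open>complex ^ 'n ^ 'm\<close>, with
  \<open>CARD('m) = m\<close> and \<open>CARD('n) = n\<close>. The scalar matrix \<open>c I\<close> is \<open>mat c\<close>.\<close>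

definition conj_transpose :: "complex ^ 'n ^ 'm \<Rightarrow> complex ^ 'm ^ 'n" where
  "conj_transpose A = (\<chi> i j. cnj (A $ j $ i))"

definition scale_matrix :: "complex \<Rightarrow> complex ^ 'n ^ 'm \<Rightarrow> complex ^ 'n ^ 'm"
    (infixr \<open>*\<^sub>C\<close> 75) where
  "c *\<^sub>C A = (\<chi> i j. c * A $ i $ j)"

text \<open>The rows and columns of \<open>[A, B; C, D]\<close> are indexed by sum types; \<open>Inl\<close> is the
  first block and \<open>Inr\<close> the second.\<close>

definition block_matrix ::
  "'a ^ 'n ^ 'm \<Rightarrow> 'a ^ 'k ^ 'm \<Rightarrow> 'a ^ 'n ^ 'l \<Rightarrow> 'a ^ 'k ^ 'l \<Rightarrow> 'a ^ ('n + 'k) ^ ('m + 'l)" where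
  "block_matrix A B C D = (\<chi> i j.
     (case i of
        Inl i' \<Rightarrow> (case j of Inl j' \<Rightarrow> A $ i' $ j' | Inr j' \<Rightarrow> B $ i' $ j')
      | Inr i' \<Rightarrow> (case j of Inl j' \<Rightarrow> C $ i' $ j' | Inr j' \<Rightarrow> D $ i' $ j')))"

definition is_eigenvalue :: "complex ^ 'n ^ 'n \<Rightarrow> complex \<Rightarrow> bool" where
  "is_eigenvalue A k \<longleftrightarrow> (\<exists>v. v \<noteq> 0 \<and> A *v v = k *s v)"

text \<open>Meant for matrices with real spectrum, on which \<open>Re\<close> only changes the type.\<close>

definition lambda_min :: "complex ^ 'n ^ 'n \<Rightarrow> real" where
  "lambda_min A = Min (Re ` {k. is_eigenvalue A k})"

definition is_singular_value :: "complex ^ 'n ^ 'n \<Rightarrow> real \<Rightarrow> bool" where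
  "is_singular_value A s \<longleftrightarrow>
     0 \<le> s \<and> is_eigenvalue (conj_transpose A ** A) (complex_of_real (s\<^sup>2))"

definition sigma_min :: "complex ^ 'n ^ 'n \<Rightarrow> real" where
  "sigma_min A = Min {s. is_singular_value A s}"

definition spectral_norm :: "complex ^ 'n ^ 'm \<Rightarrow> real" where
  "spectral_norm A = onorm (\<lambda>x. A *v x)"

text \<open>The case distinction is needed because \<^const>\<open>matrix_inv\<close> is unspecified on singular
  matrices.\<close>

definition inv_norm_inv :: "complex ^ 'n ^ 'n \<Rightarrow> real" where
  "inv_norm_inv A = (if invertible A then inverse (spectral_norm (matrix_inv A)) else 0)"

definition pseudospectrum :: "real \<Rightarrow> complex ^ 'n ^ 'n \<Rightarrow> complex set" where
  "pseudospectrum \<epsilon> A = {z. inv_norm_inv (A - mat z) \<le> \<epsilon>}"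

definition M_matrix ::
  "complex ^ 'r ^ 'd \<Rightarrow> complex ^ 'r ^ 'd \<Rightarrow> complex \<Rightarrow> complex ^ ('r + 'r) ^ ('r + 'r)" where
  "M_matrix U V z =
     block_matrix
       (mat (complex_of_real ((cmod z)\<^sup>2)) - z *\<^sub>C (conj_transpose U ** V))
       ((mat (complex_of_real ((cmod z)\<^sup>2)) - z *\<^sub>C (conj_transpose U ** V))
          ** (conj_transpose U ** U))
       (conj_transpose V ** V)
       (mat (complex_of_real ((cmod z)\<^sup>2)) - cnj z *\<^sub>C (conj_transpose V ** U)
          + (conj_transpose V ** V) ** (conj_transpose U ** U))"

definition mu :: "complex ^ 'r ^ 'd \<Rightarrow> complex ^ 'r ^ 'd \<Rightarrow> complex \<Rightarrow> real" where
  "mu U V z = sqrt (lambda_min (M_matrix U V z))"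

end

theory Submission
  imports Defs
begin

text \<open>Put \<open>B = zI - UV\<^sup>*\<close>, let \<open>X\<close> be the column of blocks \<open>-zU\<^sup>*, V\<^sup>*\<close> and \<open>Y\<close> the row of
  blocks \<open>V, -B\<^sup>*U\<close>. Then \<open>M = |z|\<^sup>2I + XY\<close> and \<open>B\<^sup>*B = |z|\<^sup>2I + YX\<close>, so the two spectra agree away
  from \<open>|z|\<^sup>2\<close>. Since \<open>V\<^sup>*\<close> has a kernel, on which \<open>B\<close> multiplies norms by \<open>|z|\<close>, the least eigenvalue
  of \<open>B\<^sup>*B\<close> is at most \<open>|z|\<^sup>2\<close>. If it equals \<open>|z|\<^sup>2\<close>, then \<open>YX\<close> is positive semidefinite and hence
  vanishes on the kernel of \<open>V\<^sup>*\<close>; were \<open>XY\<close> injective, \<open>X\<close> would be surjective and yet vanish on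
  that kernel, which is absurd. So \<open>|z|\<^sup>2\<close> is then an eigenvalue of \<open>M\<close> too.\<close>

section \<open>Matrix algebra\<close>

lemma mat_mult_vec: "mat c *v x = (c::complex) *s x"
  by (simp add: mat_def matrix_vector_mult_def vec_eq_iff if_distrib if_distribR cong: if_cong)

lemma scale_matrix_mult_vec: "(c *\<^sub>C A) *v x = c *s (A *v x)"
  by (simp add: scale_matrix_def matrix_vector_mult_def vec_eq_iff sum_distrib_left mult.assoc)

lemma matrix_mult_vec_smult: "A *v (c *s x) = (c::complex) *s (A *v x)"
  by (simp add: matrix_vector_mult_def vec_eq_iff sum_distrib_left mult.left_commute)

lemma matrix_uminus_mult_vec: "(- A) *v x = - (A *v (x :: complex ^ 'n))"
  by (simp add: matrix_vector_mult_def vec_eq_iff sum_negf)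

lemma matrix_mult_vec_uminus: "A *v (- x) = - (A *v (x :: complex ^ 'n))"
  by (simp add: matrix_vector_mult_def vec_eq_iff sum_negf)

lemma conj_transpose_conj_transpose [simp]: "conj_transpose (conj_transpose A) = A"
  by (simp add: conj_transpose_def vec_eq_iff)

lemma conj_transpose_mult: "conj_transpose (A ** B) = conj_transpose B ** conj_transpose A"
  by (simp add: conj_transpose_def matrix_matrix_mult_def vec_eq_iff mult.commute)

lemma conj_transpose_diff: "conj_transpose (A - B) = conj_transpose A - conj_transpose B"
  by (simp add: conj_transpose_def vec_eq_iff)

lemma conj_transpose_mat: "conj_transpose (mat c) = mat (cnj c)"
  by (simp add: conj_transpose_def mat_def vec_eq_iff)

text \<open>Rewrites the action of a composite matrix on a vector into nested actions and scalar
  multiples, so that the block identities below can be checked vector by vector.\<close>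

lemmas mult_vec_simps =
  conj_transpose_diff conj_transpose_mat conj_transpose_mult
  matrix_vector_mult_add_rdistrib matrix_vector_mult_diff_rdistrib matrix_vector_mult_diff_distrib
  scale_matrix_mult_vec mat_mult_vec matrix_mult_vec_smult matrix_uminus_mult_vec matrix_mult_vec_uminus
  vector_ssub_ldistrib vector_smult_assoc

text \<open>The inner product on \<open>complex ^ 'n\<close> is the real one, the real part of the
  Hermitian product. Taking adjoints survives passing to real parts.\<close>

lemma inner_mult_vec_right:
  fixes A :: "complex ^ 'n ^ 'm"
  shows "x \<bullet> (A *v y) = (conj_transpose A *v x) \<bullet> y"
proof -
  have adj: "a \<bullet> (b * c) = (cnj b * a) \<bullet> c" for a b c :: complex
    by (simp add: inner_complex_def algebra_simps)
  have "x \<bullet> (A *v y) = (\<Sum>i\<in>UNIV. \<Sum>j\<in>UNIV. x $ i \<bullet> (A $ i $ j * y $ j))"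
    by (simp add: inner_vec_def matrix_vector_mult_def inner_sum_right)
  also have "\<dots> = (\<Sum>j\<in>UNIV. \<Sum>i\<in>UNIV. x $ i \<bullet> (A $ i $ j * y $ j))"
    by (rule sum.swap)
  also have "\<dots> = (conj_transpose A *v x) \<bullet> y"
    by (simp add: inner_vec_def matrix_vector_mult_def inner_sum_left conj_transpose_def adj)
  finally show ?thesis .
qed

lemma norm_mult_vec_sq:
  fixes A :: "complex ^ 'n ^ 'm"
  shows "(norm (A *v x))\<^sup>2 = x \<bullet> ((conj_transpose A ** A) *v x)"
  by (simp add: power2_norm_eq_inner inner_mult_vec_right conj_transpose_mult matrix_vector_mul_assoc)

lemma inner_smult_smult:
  fixes x :: "complex ^ 'n"
  shows "(a *s x) \<bullet> (b *s x) = (a \<bullet> b) * (norm x)\<^sup>2"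
  by (simp add: power2_norm_eq_inner inner_vec_def inner_complex_def sum_distrib_left algebra_simps)

lemma of_real_smult_vec: "complex_of_real c *s x = c *\<^sub>R x"
  by (simp add: vec_eq_iff complex_eq_iff)

lemma norm_smult_vec:
  fixes x :: "complex ^ 'n"
  shows "norm (c *s x) = cmod c * norm x"
proof (rule power2_eq_imp_eq)
  show "(norm (c *s x))\<^sup>2 = (cmod c * norm x)\<^sup>2"
    unfolding power2_norm_eq_inner[of "c *s x"] inner_smult_smult
    by (simp add: power_mult_distrib power2_norm_eq_inner)
qed simp_all

text \<open>Dimension count over the reals: an injective map would preserve \<open>dim\<close>, but
  the target has the smaller one.\<close>

lemma mult_vec_kernel_nontrivial:
  fixes A :: "complex ^ 'n ^ 'm"
  assumes "CARD('m) < CARD('n)"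
  obtains v where "v \<noteq> 0" "A *v v = 0"
proof -
  have "\<not> inj ((*v) A)"
  proof
    assume inj: "inj ((*v) A)"
    have "dim ((*v) A ` UNIV) = dim (UNIV :: (complex ^ 'n) set)"
      by (rule dim_image_eq) (use inj in auto)
    moreover have "dim ((*v) A ` UNIV) \<le> DIM(complex ^ 'm)"
      by (rule dim_subset_UNIV)
    ultimately show False
      using assms by simp
  qed
  then show thesis
    using that vec.inj_iff_eq_0[of A] by blast
qed

section \<open>Smallest singular value\<close>

text \<open>If \<open>f v\<close> were nonzero, moving from \<open>v\<close> slightly against
  \<open>f v\<close> would make the quadratic form negative, since its linear term dominates for
  small steps.\<close>

lemma psd_kernel:
  fixes f :: "'a::real_inner \<Rightarrow> 'a"
  assumes "linear f" and sym: "\<And>x y. x \<bullet> f y = f x \<bullet> y"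
    and psd: "\<And>x. 0 \<le> x \<bullet> f x" and "v \<bullet> f v = 0"
  shows "f v = 0"
proof (rule ccontr)
  interpret linear f by fact
  assume "f v \<noteq> 0"
  define a where "a = f v \<bullet> f v"
  define b where "b = f v \<bullet> f (f v)"
  have "a > 0" "b \<ge> 0"
    using \<open>f v \<noteq> 0\<close> psd by (auto simp: a_def b_def)
  \<comment> \<open>Up to the shift by 1, this minimizes \<open>2 * t * a + t\<^sup>2 * b\<close>;
    the shift keeps the denominator positive when \<open>b = 0\<close>.\<close>
  define t where "t = - a / (b + 1)"
  have "0 \<le> (v + t *\<^sub>R f v) \<bullet> f (v + t *\<^sub>R f v)"
    by (rule psd)
  also have "\<dots> = 2 * t * a + t\<^sup>2 * b"
    by (simp add: add scale a_def b_def \<open>v \<bullet> f v = 0\<close> sym[of v "f v"] inner_add_left inner_add_right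
        power2_eq_square algebra_simps)
  also have "\<dots> < 0"
  proof -
    have "t\<^sup>2 * b \<le> t\<^sup>2 * (b + 1)" by (simp add: mult_left_mono)
    also have "\<dots> = t * (t * (b + 1))" by (simp add: power2_eq_square)
    also have "t * (b + 1) = - a" using \<open>b \<ge> 0\<close> by (simp add: t_def)
    moreover have "t * a < 0" using \<open>a > 0\<close> \<open>b \<ge> 0\<close> by (simp add: t_def field_simps)
    ultimately show ?thesis by simp
  qed
  finally show False by simp
qed

text \<open>Compactness of the unit sphere gives a minimizer of \<open>norm (A *v x)\<close>;
  homogeneity extends the bound to all vectors.\<close>

lemma min_stretch_exists:
  fixes A :: "complex ^ 'n ^ 'm"
  obtains v where "norm v = 1" "\<And>x. norm (A *v v) * norm x \<le> norm (A *v x)"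
proof -
  have "axis undefined 1 \<in> sphere (0 :: complex ^ 'n) 1"
    by simp
  then have "\<exists>v\<in>sphere 0 1. \<forall>x\<in>sphere 0 1. norm (A *v v) \<le> norm (A *v x)"
    by (intro continuous_attains_inf continuous_on_norm linear_continuous_on) auto
  then obtain v where v: "norm v = 1" "\<And>x. norm x = 1 \<Longrightarrow> norm (A *v v) \<le> norm (A *v x)"
    by auto
  have "norm (A *v v) * norm x \<le> norm (A *v x)" for x
  proof (cases "x = 0")
    case False
    then have "norm (A *v v) \<le> norm (A *v (inverse (norm x) *\<^sub>R x))"
      by (intro v) simp
    then show ?thesis
      using False by (simp add: linear_scale[OF matrix_vector_mul_linear] field_simps)
  qed simp
  with v(1) show thesis by (rule that)
qed

text \<open>The form of the Gram matrix minus \<open>c\<^sup>2\<close> is the difference of the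
  squares of \<open>norm (A *v x)\<close> and \<open>c * norm x\<close>. It is nonnegative and
  vanishes at \<open>v\<close>, so \<open>psd_kernel\<close> applies.\<close>

lemma gram_eigenvector_of_min_stretch:
  fixes A :: "complex ^ 'n ^ 'm"
  assumes bound: "\<And>x. c * norm x \<le> norm (A *v x)" and "0 \<le> c" and eq: "norm (A *v v) = c * norm v"
  shows "(conj_transpose A ** A) *v v = complex_of_real (c\<^sup>2) *s v"
proof -
  let ?f = "\<lambda>x. (conj_transpose A ** A) *v x - c\<^sup>2 *\<^sub>R x"
  have form: "x \<bullet> ?f x = (norm (A *v x))\<^sup>2 - (c * norm x)\<^sup>2" for x
    unfolding norm_mult_vec_sq by (simp add: inner_diff_right power_mult_distrib power2_norm_eq_inner)
  have "?f v = 0"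
  proof (rule psd_kernel[of ?f])
    show "linear ?f"
      by (intro linear_compose_sub matrix_vector_mul_linear linear_scale_self)
    show "x \<bullet> ?f y = ?f x \<bullet> y" for x y
      by (simp add: inner_diff_left inner_diff_right inner_mult_vec_right conj_transpose_mult)
    show "0 \<le> x \<bullet> ?f x" for x
      unfolding form using bound \<open>0 \<le> c\<close> by (simp add: power_mono)
    show "v \<bullet> ?f v = 0"
      unfolding form by (simp add: eq)
  qed
  then show ?thesis
    by (simp add: of_real_smult_vec del: of_real_power)
qed

lemma gram_eigenvalue:
  fixes A :: "complex ^ 'n ^ 'm"
  assumes "(conj_transpose A ** A) *v v = k *s v" "v \<noteq> 0"
  shows "k \<in> \<real>" "(norm (A *v v))\<^sup>2 = Re k * (norm v)\<^sup>2"
proof -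
  have re: "(a *s v) \<bullet> ((conj_transpose A ** A) *v v) = (a \<bullet> k) * (norm v)\<^sup>2" for a
    by (simp add: assms inner_smult_smult)
  show "(norm (A *v v))\<^sup>2 = Re k * (norm v)\<^sup>2"
    using re[of 1] by (simp add: norm_mult_vec_sq inner_complex_def)
  \<comment> \<open>Pairing with \<open>\<i> *s v\<close> in the real inner product isolates
    \<open>Im k\<close>.\<close>
  have "(\<i> *s v) \<bullet> ((conj_transpose A ** A) *v v) = (\<i> *s (A *v v)) \<bullet> (1 *s (A *v v))"
    by (simp add: inner_mult_vec_right matrix_mult_vec_smult flip: matrix_vector_mul_assoc)
  also have "\<dots> = 0"
    by (simp only: inner_smult_smult) (simp add: inner_complex_def)
  finally have "Im k = 0"
    using re[of \<i>] \<open>v \<noteq> 0\<close> by (simp add: inner_complex_def)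
  then show "k \<in> \<real>"
    by (simp add: complex_is_Real_iff)
qed

text \<open>Eigenvectors for distinct eigenvalues are orthogonal, hence independent over the reals
  in a finite-dimensional space. Finiteness gives meaning to \<open>Min\<close> in
  \<open>sigma_min\<close> and \<open>lambda_min\<close>.\<close>

lemma finite_gram_eigenvalues:
  fixes A :: "complex ^ 'n ^ 'm"
  shows "finite {k. is_eigenvalue (conj_transpose A ** A) k}" (is "finite ?K")
proof -
  have "\<forall>k\<in>?K. \<exists>v. v \<noteq> 0 \<and> (conj_transpose A ** A) *v v = k *s v"
    by (simp add: is_eigenvalue_def)
  then obtain e where e: "\<And>k. k \<in> ?K \<Longrightarrow> e k \<noteq> 0 \<and> (conj_transpose A ** A) *v e k = k *s e k"
    by metis
  have real: "complex_of_real (Re k) = k" if "k \<in> ?K" for k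
    using gram_eigenvalue(1) e[OF that] by (metis of_real_Re)
  have scaleR: "k *s x = Re k *\<^sub>R x" if "k \<in> ?K" for k and x :: "complex ^ 'n"
    using of_real_smult_vec[of "Re k" x] unfolding real[OF that] .
  have orth: "e k \<bullet> e l = 0" if "k \<in> ?K" "l \<in> ?K" "k \<noteq> l" for k l
  proof -
    have "Re l * (e k \<bullet> e l) = e k \<bullet> (l *s e l)"
      by (simp only: scaleR[OF that(2)] inner_scaleR_right)
    also have "\<dots> = (k *s e k) \<bullet> e l"
      using e[OF that(1)] e[OF that(2)] inner_mult_vec_right[of "e k" "conj_transpose A ** A" "e l"]
      by (simp add: conj_transpose_mult)
    also have "\<dots> = Re k * (e k \<bullet> e l)"
      by (simp only: scaleR[OF that(1)] inner_scaleR_left)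
    finally show ?thesis
      using that real by (metis mult_cancel_right)
  qed
  have "inj_on e ?K"
    using orth e by (metis inj_onI inner_eq_zero_iff)
  moreover have "independent (e ` ?K)"
    using orth e by (intro pairwise_orthogonal_independent) (auto simp: pairwise_def orthogonal_def)
  then have "finite (e ` ?K)"
    by (rule independent_imp_finite)
  ultimately show ?thesis
    by (simp add: finite_image_iff)
qed

text \<open>Variational characterization: any lower stretch bound that some nonzero vector attains
  is the least singular value.\<close>

lemma sigma_min_eqI:
  fixes A :: "complex ^ 'n ^ 'n"
  assumes bound: "\<And>x. c * norm x \<le> norm (A *v x)" and "0 \<le> c" and "norm (A *v v) = c * norm v" "v \<noteq> 0"
  shows "sigma_min A = c"
  unfolding sigma_min_def
proof (rule Min_eqI)
  \<comment> \<open>Squaring embeds the singular values, being nonnegative, into the finite set of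
    Gram eigenvalues.\<close>
  have "inj_on (\<lambda>s. complex_of_real (s\<^sup>2)) {s. is_singular_value A s}"
    by (auto simp: inj_on_def is_singular_value_def simp flip: of_real_power)
  moreover have "(\<lambda>s. complex_of_real (s\<^sup>2)) ` {s. is_singular_value A s}
      \<subseteq> {k. is_eigenvalue (conj_transpose A ** A) k}"
    by (auto simp: is_singular_value_def)
  ultimately show "finite {s. is_singular_value A s}"
    using finite_gram_eigenvalues by (rule inj_on_finite)
  show "c \<in> {s. is_singular_value A s}"
    using gram_eigenvector_of_min_stretch[OF assms(1-3)] assms
    by (auto simp: is_singular_value_def is_eigenvalue_def)
  fix s
  assume "s \<in> {s. is_singular_value A s}"
  then obtain w where w: "(conj_transpose A ** A) *v w = complex_of_real (s\<^sup>2) *s w" "w \<noteq> 0" "0 \<le> s"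
    by (auto simp: is_singular_value_def is_eigenvalue_def)
  then have "(norm (A *v w))\<^sup>2 = (s * norm w)\<^sup>2"
    using gram_eigenvalue(2)[OF w(1,2)] by (simp only: Re_complex_of_real power_mult_distrib)
  then have "norm (A *v w) = s * norm w"
    using w by (simp add: power2_eq_iff_nonneg)
  then show "c \<le> s"
    using bound[of w] w by simp
qed

lemma sigma_min_attained:
  fixes A :: "complex ^ 'n ^ 'n"
  obtains v where "norm v = 1" "norm (A *v v) = sigma_min A"
    "\<And>x. sigma_min A * norm x \<le> norm (A *v x)"
proof -
  obtain v where v: "norm v = 1" "\<And>x. norm (A *v v) * norm x \<le> norm (A *v x)"
    by (rule min_stretch_exists[of A]) blast
  have "sigma_min A = norm (A *v v)"
    by (rule sigma_min_eqI[where v = v]) (use v in auto)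
  with v that show thesis by simp
qed

lemma sigma_min_nonneg: "0 \<le> sigma_min A"
  by (metis sigma_min_attained norm_ge_zero)

lemma sigma_min_uminus: "sigma_min (- A) = sigma_min A"
proof -
  have "conj_transpose (- A) ** (- A) = conj_transpose A ** A"
    by (simp add: conj_transpose_def matrix_matrix_mult_def)
  then show ?thesis
    by (simp add: sigma_min_def is_singular_value_def)
qed

text \<open>The largest stretch of the inverse is the reciprocal of the least stretch of
  \<open>A\<close>. For singular \<open>A\<close> a kernel vector forces
  \<open>sigma_min A = 0\<close>, in line with the convention.\<close>

lemma inv_norm_inv_eq_sigma_min:
  fixes A :: "complex ^ 'n ^ 'n"
  shows "inv_norm_inv A = sigma_min A"
proof -
  obtain v where v: "norm v = 1" "norm (A *v v) = sigma_min A"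
    and bound: "\<And>x. sigma_min A * norm x \<le> norm (A *v x)"
    by (rule sigma_min_attained[of A]) blast
  show ?thesis
  proof (cases "invertible A")
    case True
    then have inv: "A *v (matrix_inv A *v x) = x" "matrix_inv A *v (A *v x) = x" for x
      using someI_ex[of "\<lambda>B. A ** B = mat 1 \<and> B ** A = mat 1"]
      by (simp_all add: invertible_def matrix_inv_def matrix_vector_mul_assoc)
    have pos: "sigma_min A > 0"
      using v inv(2)[of v] by (metis matrix_vector_mult_0_right norm_zero zero_less_norm_iff zero_neq_one)
    have "onorm ((*v) (matrix_inv A)) = inverse (sigma_min A)"
    proof (rule antisym)
      show "onorm ((*v) (matrix_inv A)) \<le> inverse (sigma_min A)"
      proof (rule onorm_le)
        fix x
        show "norm (matrix_inv A *v x) \<le> inverse (sigma_min A) * norm x"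
          using bound[of "matrix_inv A *v x"] pos by (simp add: inv field_simps)
      qed
      \<comment> \<open>The image of the minimizer \<open>v\<close> attains the operator norm of the
        inverse.\<close>
      have "norm (matrix_inv A *v (A *v v)) \<le> onorm ((*v) (matrix_inv A)) * norm (A *v v)"
        by (intro onorm matrix_vector_mul_bounded_linear)
      then show "inverse (sigma_min A) \<le> onorm ((*v) (matrix_inv A))"
        using pos v by (simp add: inv field_simps)
    qed
    then show ?thesis
      using True by (simp add: inv_norm_inv_def spectral_norm_def)
  next
    case False
    then obtain x where "A *v x = 0" "x \<noteq> 0"
      using matrix_left_invertible_ker[of A] by (auto simp: invertible_left_inverse)
    then have "sigma_min A \<le> 0"
      using bound[of x] by (simp add: mult_le_0_iff)
    then have "sigma_min A = 0"
      using v by (metis antisym norm_ge_zero)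
    then show ?thesis
      using False by (simp add: inv_norm_inv_def)
  qed
qed

lemma lambda_min_eqI:
  assumes "finite {k. is_eigenvalue A k}" "is_eigenvalue A (complex_of_real c)"
    and "\<And>k. is_eigenvalue A k \<Longrightarrow> c \<le> Re k"
  shows "lambda_min A = c"
  unfolding lambda_min_def
proof (rule Min_eqI)
  show "finite (Re ` {k. is_eigenvalue A k})"
    using assms(1) by simp
  show "c \<le> x" if "x \<in> Re ` {k. is_eigenvalue A k}" for x
    using that assms(3) by auto
  show "c \<in> Re ` {k. is_eigenvalue A k}"
    using assms(2) by (intro image_eqI[of _ _ "complex_of_real c"]) auto
qed

section \<open>The block factorization\<close>

text \<open>\<open>Y\<close> carries an eigenvector \<open>v\<close> of the first matrix to one of
  the second; \<open>Y *v v\<close> is nonzero because \<open>X\<close> sends it to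
  \<open>(k - c) *s v\<close>.\<close>

lemma is_eigenvalue_mult_commute:
  assumes "is_eigenvalue (mat c + X ** Y) k" "k \<noteq> c"
  shows "is_eigenvalue (mat c + Y ** X) k"
proof -
  obtain v where "v \<noteq> 0" "(mat c + X ** Y) *v v = k *s v"
    using assms(1) by (auto simp: is_eigenvalue_def)
  then have "c *s v + X *v (Y *v v) = k *s v"
    by (simp only: matrix_vector_mult_add_rdistrib mat_mult_vec matrix_vector_mul_assoc)
  then have XY: "X *v (Y *v v) = (k - c) *s v"
    by (metis add_diff_cancel_left' vector_sub_rdistrib)
  then have "Y *v v \<noteq> 0"
    using \<open>v \<noteq> 0\<close> \<open>k \<noteq> c\<close> by (metis matrix_vector_mult_0_right right_minus_eq vector_mul_eq_0)
  moreover have "(mat c + Y ** X) *v (Y *v v) = c *s (Y *v v) + Y *v (X *v (Y *v v))"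
    by (simp add: matrix_vector_mult_add_rdistrib mat_mult_vec flip: matrix_vector_mul_assoc)
  then have "(mat c + Y ** X) *v (Y *v v) = k *s (Y *v v)"
    by (simp add: XY matrix_vector_mult_diff_distrib matrix_mult_vec_smult)
  ultimately show ?thesis
    by (auto simp: is_eigenvalue_def)
qed

section \<open>Block rows, block columns and their products\<close>

definition block_row :: "'a ^ 'n ^ 'm \<Rightarrow> 'a ^ 'k ^ 'm \<Rightarrow> 'a ^ ('n + 'k) ^ 'm" where
  "block_row A B = (\<chi> i j. case j of Inl j' \<Rightarrow> A $ i $ j' | Inr j' \<Rightarrow> B $ i $ j')"

definition block_column :: "'a ^ 'n ^ 'm \<Rightarrow> 'a ^ 'n ^ 'l \<Rightarrow> 'a ^ 'n ^ ('m + 'l)" where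
  "block_column A C = (\<chi> i j. case i of Inl i' \<Rightarrow> A $ i' $ j | Inr i' \<Rightarrow> C $ i' $ j)"

lemma block_column_mult_block_row:
  "block_column A C ** block_row B D = block_matrix (A ** B) (A ** D) (C ** B) (C ** D)"
  by (simp add: block_column_def block_row_def block_matrix_def matrix_matrix_mult_def vec_eq_iff
      split: sum.split)

lemma sum_UNIV_Plus:
  fixes f :: "'a::finite + 'b::finite \<Rightarrow> 'c::comm_monoid_add"
  shows "sum f UNIV = (\<Sum>i\<in>UNIV. f (Inl i)) + (\<Sum>j\<in>UNIV. f (Inr j))"
  using sum.Plus[of "UNIV :: 'a set" "UNIV :: 'b set" f] by simp

lemma block_row_mult_block_column:
  "block_row B D ** block_column A C = B ** A + D ** C"
  by (simp add: block_column_def block_row_def matrix_matrix_mult_def vec_eq_iff sum_UNIV_Plus)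

lemma block_matrix_cong:
  "\<lbrakk>A = A'; B = B'; C = C'; D = D'\<rbrakk> \<Longrightarrow> block_matrix A B C D = block_matrix A' B' C' D'"
  by simp

lemma mat_add_block_matrix:
  "mat (c :: complex) + block_matrix A B C D = block_matrix (mat c + A) B C (mat c + D)"
  by (simp add: mat_def block_matrix_def vec_eq_iff split: sum.split)

text \<open>The factor \<open>X\<close> of the overview; its lower block detects the kernel of
  \<open>conj_transpose V\<close>.\<close>

definition left_factor :: "complex ^ 'r ^ 'd \<Rightarrow> complex ^ 'r ^ 'd \<Rightarrow> complex \<Rightarrow> complex ^ 'd ^ ('r + 'r)" where
  "left_factor U V z = block_column ((- z) *\<^sub>C conj_transpose U) (conj_transpose V)"

text \<open>The factor \<open>Y\<close> of the overview.\<close>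

definition right_factor :: "complex ^ 'r ^ 'd \<Rightarrow> complex ^ 'r ^ 'd \<Rightarrow> complex \<Rightarrow> complex ^ ('r + 'r) ^ 'd" where
  "right_factor U V z = block_row V (- (conj_transpose (mat z - U ** conj_transpose V) ** U))"

lemma M_matrix_factorization:
  "M_matrix U V z = mat (complex_of_real ((cmod z)\<^sup>2)) + left_factor U V z ** right_factor U V z"
proof -
  have c: "complex_of_real ((cmod z)\<^sup>2) = z * cnj z"
    by (rule complex_norm_square)
  show ?thesis
    unfolding M_matrix_def left_factor_def right_factor_def block_column_mult_block_row
      mat_add_block_matrix c
    by (intro block_matrix_cong) (simp_all add: matrix_eq mult_vec_simps flip: matrix_vector_mul_assoc)
qed

text \<open>With \<open>B\<close> for \<open>B z\<close>, the terms with \<open>mat\<close> and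
  \<open>V\<close> on the right sum to \<open>z *\<^sub>C conj_transpose B\<close>; the remaining
  block product supplies \<open>- conj_transpose B ** U ** conj_transpose V\<close>.\<close>

lemma gram_factorization:
  fixes U V :: "complex ^ 'r ^ 'd"
  defines "B z \<equiv> mat z - U ** conj_transpose V"
  shows "conj_transpose (B z) ** B z
    = mat (complex_of_real ((cmod z)\<^sup>2)) + right_factor U V z ** left_factor U V z"
proof -
  have c: "complex_of_real ((cmod z)\<^sup>2) = z * cnj z"
    by (rule complex_norm_square)
  show ?thesis
    unfolding B_def left_factor_def right_factor_def block_row_mult_block_column c
    by (simp add: matrix_eq mult_vec_simps flip: matrix_vector_mul_assoc)
qed

section \<open>Comparison of the spectra\<close>

lemma M_matrix_eigenvalue_cases:
  fixes U V :: "complex ^ 'r ^ 'd"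
  defines "B z \<equiv> mat z - U ** conj_transpose V"
  assumes "is_eigenvalue (M_matrix U V z) k"
  shows "k = complex_of_real ((cmod z)\<^sup>2) \<or> is_eigenvalue (conj_transpose (B z) ** B z) k"
  using assms(2) is_eigenvalue_mult_commute[of _ "left_factor U V z" "right_factor U V z" k]
  unfolding M_matrix_factorization B_def gram_factorization by blast

text \<open>Covers the value at which \<open>is_eigenvalue_mult_commute\<close> says nothing, in the
  case where \<open>sigma_min (B z)\<close> equals \<open>cmod z\<close>.\<close>

lemma M_matrix_singular_shift:
  fixes U V :: "complex ^ 'r ^ 'd"
  defines "B z \<equiv> mat z - U ** conj_transpose V"
  assumes bound: "\<And>x. cmod z * norm x \<le> norm (B z *v x)"
  shows "is_eigenvalue (M_matrix U V z) (complex_of_real ((cmod z)\<^sup>2))"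
proof (rule ccontr)
  define X where "X = left_factor U V z"
  define Y where "Y = right_factor U V z"
  assume no: "\<not> ?thesis"
  have ker: "w = 0" if "(X ** Y) *v w = 0" for w
    using no that unfolding M_matrix_factorization X_def[symmetric] Y_def[symmetric]
    by (auto simp: is_eigenvalue_def matrix_vector_mult_add_rdistrib mat_mult_vec)
  then obtain Z where "Z ** (X ** Y) = mat 1"
    using matrix_left_invertible_ker by metis
  then have XYZ: "X ** Y ** Z = mat 1"
    by (simp add: matrix_left_right_inverse)
  \<comment> \<open>A vector supported in the first block: a preimage under \<open>X\<close> then
    lies in the kernel of \<open>conj_transpose V\<close>, yet its image is nonzero.\<close>
  define e :: "complex ^ ('r + 'r)" where "e = axis (Inl undefined) 1"
  define v where "v = Y *v (Z *v e)"
  have Xv: "X *v v = e"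
    using XYZ by (simp add: v_def matrix_vector_mul_assoc matrix_mul_assoc)
  have "(conj_transpose V *v v) $ j = (X *v v) $ Inr j" for j
    by (simp add: X_def left_factor_def block_column_def matrix_vector_mult_def)
  then have "conj_transpose V *v v = 0"
    by (simp add: Xv e_def vec_eq_iff axis_def)
  then have "B z *v v = z *s v"
    by (simp add: B_def matrix_vector_mult_diff_rdistrib mat_mult_vec flip: matrix_vector_mul_assoc)
  then have "norm (B z *v v) = cmod z * norm v"
    by (simp add: norm_smult_vec)
  then have "(conj_transpose (B z) ** B z) *v v = complex_of_real ((cmod z)\<^sup>2) *s v"
    using bound by (intro gram_eigenvector_of_min_stretch) auto
  \<comment> \<open>Comparing with \<open>gram_factorization\<close> cancels the shift and leaves
    \<open>Y *v (X *v v) = 0\<close>.\<close>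
  then have "Y *v e = 0"
    unfolding B_def gram_factorization X_def[symmetric] Y_def[symmetric]
    by (simp add: matrix_vector_mult_add_rdistrib mat_mult_vec Xv flip: matrix_vector_mul_assoc)
  then have "e = 0"
    using ker[of e] by (simp flip: matrix_vector_mul_assoc)
  then show False
    by (simp add: e_def)
qed

text \<open>This is where \<open>r < d\<close> enters: \<open>conj_transpose V\<close> has a nonzero
  kernel vector, on which the matrix acts as \<open>z\<close>.\<close>

lemma sigma_min_le_cmod:
  fixes U V :: "complex ^ 'r ^ 'd"
  assumes "CARD('r) < CARD('d)"
  shows "sigma_min (mat z - U ** conj_transpose V) \<le> cmod z"
proof -
  let ?B = "mat z - U ** conj_transpose V"
  obtain v where v: "v \<noteq> 0" "conj_transpose V *v v = 0"
    using mult_vec_kernel_nontrivial[OF assms] .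
  have "?B *v v = z *s v"
    by (simp add: v matrix_vector_mult_diff_rdistrib mat_mult_vec flip: matrix_vector_mul_assoc)
  moreover have "sigma_min ?B * norm v \<le> norm (?B *v v)"
    by (metis sigma_min_attained)
  ultimately show ?thesis
    using v by (simp add: norm_smult_vec)
qed

text \<open>Every eigenvalue is either a Gram eigenvalue of \<open>B\<close> or the exceptional
  value, which \<open>sigma_min_le_cmod\<close> controls.\<close>

lemma M_matrix_eigenvalue_bound:
  fixes U V :: "complex ^ 'r ^ 'd"
  assumes "CARD('r) < CARD('d)" "is_eigenvalue (M_matrix U V z) k"
  defines "B \<equiv> mat z - U ** conj_transpose V"
  shows "k \<in> \<real>" "(sigma_min B)\<^sup>2 \<le> Re k"
proof -
  obtain u where u: "norm u = 1" "norm (B *v u) = sigma_min B"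
    and bound: "\<And>x. sigma_min B * norm x \<le> norm (B *v x)"
    by (rule sigma_min_attained[of B]) blast
  have nonneg: "0 \<le> sigma_min B"
    by (rule sigma_min_nonneg)
  have le: "sigma_min B \<le> cmod z"
    using sigma_min_le_cmod[OF assms(1)] by (simp add: B_def)
  consider "k = complex_of_real ((cmod z)\<^sup>2)"
    | v where "v \<noteq> 0" "(conj_transpose B ** B) *v v = k *s v"
    using M_matrix_eigenvalue_cases[OF assms(2)] by (auto simp: B_def is_eigenvalue_def)
  then have "k \<in> \<real> \<and> (sigma_min B)\<^sup>2 \<le> Re k"
  proof cases
    case 1
    then show ?thesis
      using le nonneg by (simp add: power_mono flip: of_real_power)
  next
    case 2
    have "(sigma_min B * norm v)\<^sup>2 \<le> Re k * (norm v)\<^sup>2"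
      unfolding gram_eigenvalue(2)[OF 2(2,1), symmetric]
      using bound nonneg by (simp add: power_mono)
    then show ?thesis
      using 2 gram_eigenvalue(1) by (auto simp: power_mult_distrib)
  qed
  then show "k \<in> \<real>" "(sigma_min B)\<^sup>2 \<le> Re k" by auto
qed

lemma lambda_min_M_matrix:
  fixes U V :: "complex ^ 'r ^ 'd"
  assumes card: "CARD('r) < CARD('d)"
  shows "lambda_min (M_matrix U V z) = (sigma_min (mat z - U ** conj_transpose V))\<^sup>2"
proof -
  define B where "B = mat z - U ** conj_transpose V"
  obtain u where u: "norm u = 1" "norm (B *v u) = sigma_min B"
    and bound: "\<And>x. sigma_min B * norm x \<le> norm (B *v x)"
    by (rule sigma_min_attained[of B]) blast
  have nonneg: "0 \<le> sigma_min B"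
    by (rule sigma_min_nonneg)
  have "{k. is_eigenvalue (M_matrix U V z) k}
      \<subseteq> insert (complex_of_real ((cmod z)\<^sup>2)) {k. is_eigenvalue (conj_transpose B ** B) k}"
    using M_matrix_eigenvalue_cases by (auto simp: B_def)
  then have "finite {k. is_eigenvalue (M_matrix U V z) k}"
    using finite_gram_eigenvalues finite_subset by (metis finite_insert)
  moreover have "is_eigenvalue (M_matrix U V z) (complex_of_real ((sigma_min B)\<^sup>2))"
  \<comment> \<open>Away from equality the eigenvalue transfers from the Gram matrix by commuting
    the factors; at equality the singular shift provides it.\<close>
  proof (cases "sigma_min B = cmod z")
    case True
    then show ?thesis
      using M_matrix_singular_shift[of z U V] bound by (simp add: B_def)
  next
    case False
    have "(conj_transpose B ** B) *v u = complex_of_real ((sigma_min B)\<^sup>2) *s u"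
      using bound nonneg u by (intro gram_eigenvector_of_min_stretch) auto
    then have "is_eigenvalue (conj_transpose B ** B) (complex_of_real ((sigma_min B)\<^sup>2))"
      using u unfolding is_eigenvalue_def by (intro exI[of _ u]) auto
    moreover have "complex_of_real ((sigma_min B)\<^sup>2) \<noteq> complex_of_real ((cmod z)\<^sup>2)"
      using False nonneg by (simp add: power2_eq_iff_nonneg del: of_real_power)
    ultimately show ?thesis
      unfolding B_def M_matrix_factorization gram_factorization by (rule is_eigenvalue_mult_commute)
  qed
  ultimately show ?thesis
    using M_matrix_eigenvalue_bound(2)[OF card] unfolding B_def by (rule lambda_min_eqI)
qed

theorem theorem1:
  fixes U V :: "complex ^ 'r ^ 'd"
  assumes "CARD('r) < CARD('d)"
  shows "(\<forall>z. (\<forall>k. is_eigenvalue (M_matrix U V z) k \<longrightarrow> k \<in> \<real> \<and> 0 \<le> Re k)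
              \<and> mu U V z = sigma_min (mat z - U ** conj_transpose V))
       \<and> (\<forall>\<epsilon>>0. pseudospectrum \<epsilon> (U ** conj_transpose V) = {z. mu U V z \<le> \<epsilon>})"
proof -
  have mu: "mu U V z = sigma_min (mat z - U ** conj_transpose V)" for z
    by (simp add: mu_def lambda_min_M_matrix[OF assms] sigma_min_nonneg)
  have "k \<in> \<real> \<and> 0 \<le> Re k" if "is_eigenvalue (M_matrix U V z) k" for z k
    using M_matrix_eigenvalue_bound[OF assms that] by (meson order_trans zero_le_power2)
  \<comment> \<open>The pseudospectrum is defined through \<open>A - z\<close> and \<open>mu\<close>
    is matched with \<open>z - A\<close>; the sign leaves singular values unchanged.\<close>
  moreover have "inv_norm_inv (U ** conj_transpose V - mat z) = mu U V z" for z
    using sigma_min_uminus[of "mat z - U ** conj_transpose V"]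
    by (simp add: inv_norm_inv_eq_sigma_min mu)
  ultimately show ?thesis
    using mu by (simp add: pseudospectrum_def)
qed

end
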